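(* Let $K$ be a number field and let $X=\{a\in\mathbb{A}_K: a(v)\in\{0,1\}\text{ for all but finitely many places }v\}$ (i.e. the set of $a$ with $\mathrm{Fin}([[a\neq a^2]])$). Then $X$ is not a finite Boolean combination of open subsets of $\mathbb{A}_K$.
   Context: $\mathbb{A}_K$ is the adele ring of $K$ (restricted direct product of all completions $K_v$ with respect to the valuation rings $\mathcal{O}_v$ at the non-archimedean places) with the restricted product topology, whose basic open sets are $\prod_v U_v$ with $U_v\subseteq K_v$ open and $U_v=\mathcal{O}_v$ for almost all $v$. *)

theory Defs
  imports "HOL-Analysis.Analysis" "HOL-Algebra.QuotRing"
begin

definition number_field :: "'a::field_char_0 itself \<Rightarrow> bool" where
  "number_field _ \<longleftrightarrow>
     (\<exists>B::'a set. finite B \<and> module.span (\<lambda>q x. of_rat q * x) B = UNIV)"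

text \<open>Places are equivalence classes of nontrivial real-valued absolute values.\<close>

definition absolute_value :: "('a::field \<Rightarrow> real) \<Rightarrow> bool" where
  "absolute_value f \<longleftrightarrow>
     (\<forall>x. 0 \<le> f x) \<and> (\<forall>x. f x = 0 \<longleftrightarrow> x = 0) \<and>
     (\<forall>x y. f (x * y) = f x * f y) \<and> (\<forall>x y. f (x + y) \<le> f x + f y)"

definition nontrivial_absolute_values :: "('a::field \<Rightarrow> real) set" where
  "nontrivial_absolute_values = {f. absolute_value f \<and> (\<exists>x. x \<noteq> 0 \<and> f x \<noteq> 1)}"

definition equivalent_absolute_values :: "(('a::field \<Rightarrow> real) \<times> ('a \<Rightarrow> real)) set" where
  "equivalent_absolute_values =
     {(f, g). f \<in> nontrivial_absolute_values \<and> g \<in> nontrivial_absolute_values \<and>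
              (\<exists>s>0. \<forall>x. g x = f x powr s)}"

type_synonym 'a place = "('a \<Rightarrow> real) set"

definition places :: "'a::field place set" where
  "places = nontrivial_absolute_values // equivalent_absolute_values"

text \<open>A fixed representative of each place. None of the rings, subsets and topologies below
  depends on this choice.\<close>

definition place_abs :: "'a::field place \<Rightarrow> 'a \<Rightarrow> real" where
  "place_abs v = (SOME f. f \<in> v)"

definition nonarchimedean :: "'a::field place \<Rightarrow> bool" where
  "nonarchimedean v \<longleftrightarrow>
     (\<forall>x y. place_abs v (x + y) \<le> max (place_abs v x) (place_abs v y))"

text \<open>The completion at a place is the ring of Cauchy sequences modulo the ideal of null sequences, so
  its elements are cosets.\<close>

definition cauchy_ring :: "'a::field place \<Rightarrow> (nat \<Rightarrow> 'a) ring" where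
  "cauchy_ring v =
     \<lparr>carrier = {s. \<forall>e>0. \<exists>N. \<forall>m\<ge>N. \<forall>n\<ge>N. place_abs v (s m - s n) < e},
      mult = (\<lambda>s t n. s n * t n), one = (\<lambda>n. 1),
      zero = (\<lambda>n. 0), add = (\<lambda>s t n. s n + t n)\<rparr>"

definition null_ideal :: "'a::field place \<Rightarrow> (nat \<Rightarrow> 'a) set" where
  "null_ideal v = {s \<in> carrier (cauchy_ring v). (\<lambda>n. place_abs v (s n)) \<longlonglongrightarrow> 0}"

definition completion_at :: "'a::field place \<Rightarrow> (nat \<Rightarrow> 'a) set ring" where
  "completion_at v = cauchy_ring v Quot null_ideal v"

definition completion_abs :: "'a::field place \<Rightarrow> (nat \<Rightarrow> 'a) set \<Rightarrow> real" where
  "completion_abs v A = (THE r. \<forall>s\<in>A. (\<lambda>n. place_abs v (s n)) \<longlonglongrightarrow> r)"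

definition completion_topology :: "'a::field place \<Rightarrow> (nat \<Rightarrow> 'a) set topology" where
  "completion_topology v =
     Metric_space.mtopology (carrier (completion_at v))
       (\<lambda>x y. completion_abs v (x \<ominus>\<^bsub>completion_at v\<^esub> y))"

definition valuation_ring :: "'a::field place \<Rightarrow> (nat \<Rightarrow> 'a) set set" where
  "valuation_ring v = {x \<in> carrier (completion_at v). completion_abs v x \<le> 1}"

text \<open>Adeles are extensional functions on the set of places. The valuation ring is meaningful only
  at the non-archimedean places, so integrality is required at almost all of those; a number field
  has only finitely many archimedean places.\<close>

type_synonym 'a adele = "'a place \<Rightarrow> (nat \<Rightarrow> 'a) set"

definition adele_ring :: "'a::field adele ring" where
  "adele_ring =
     \<lparr>carrier = {a \<in> \<Pi>\<^sub>E v\<in>places. carrier (completion_at v).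
                   finite {v \<in> places. nonarchimedean v \<and> a v \<notin> valuation_ring v}},
      mult = (\<lambda>a b. \<lambda>v\<in>places. a v \<otimes>\<^bsub>completion_at v\<^esub> b v),
      one = (\<lambda>v\<in>places. \<one>\<^bsub>completion_at v\<^esub>),
      zero = (\<lambda>v\<in>places. \<zero>\<^bsub>completion_at v\<^esub>),
      add = (\<lambda>a b. \<lambda>v\<in>places. a v \<oplus>\<^bsub>completion_at v\<^esub> b v)\<rparr>"

definition adele_basic_open_sets :: "'a::field adele set set" where
  "adele_basic_open_sets =
     {\<Pi>\<^sub>E v\<in>places. U v | U.
        (\<forall>v\<in>places. openin (completion_topology v) (U v)) \<and>
        finite {v \<in> places. nonarchimedean v \<and> U v \<noteq> valuation_ring v}}"

definition adele_topology :: "'a::field adele topology" where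
  "adele_topology = topology_generated_by adele_basic_open_sets"

text \<open>Complements are relative to the ambient set \<Omega>.\<close>

inductive_set boolean_combinations :: "'b set \<Rightarrow> 'b set set \<Rightarrow> 'b set set"
  for \<Omega> :: "'b set" and G :: "'b set set" where
  generator: "S \<in> G \<Longrightarrow> S \<in> boolean_combinations \<Omega> G"
| complement: "S \<in> boolean_combinations \<Omega> G \<Longrightarrow> \<Omega> - S \<in> boolean_combinations \<Omega> G"
| union: "S \<in> boolean_combinations \<Omega> G \<Longrightarrow> T \<in> boolean_combinations \<Omega> G \<Longrightarrow>
            S \<union> T \<in> boolean_combinations \<Omega> G"
| intersection: "S \<in> boolean_combinations \<Omega> G \<Longrightarrow> T \<in> boolean_combinations \<Omega> G \<Longrightarrow>
            S \<inter> T \<in> boolean_combinations \<Omega> G"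

end

theory Submission
  imports Defs
begin

text \<open>Let F be the set of adeles that vanish at all archimedean places. Every basic open set that
  meets F contains a point of F that is 0 at almost all non-archimedean places, and one that is -1
  there; so X and its complement are both dense in F. A Boolean combination of open sets, in
  contrast, contains or misses a nonempty relatively open piece of F.

  This uses that there are infinitely many non-archimedean places. For a prime p, a
  maximal subring A of K that does not contain 1/p is a valuation ring, and since K is algebraic
  over the rationals, A has rank one: the supremum v(x) of all k/m with x^m / p^k in A is finite,
  and 2 powr (-v(x)) is an absolute value with value less than 1 at p and at no other prime.\<close>

section \<open>Maximal subrings avoiding 1/p\<close>

definition unital_subring :: "'a::comm_ring_1 set \<Rightarrow> bool" where
  "unital_subring A \<longleftrightarrow> 1 \<in> A \<and> (\<forall>x\<in>A. \<forall>y\<in>A. x - y \<in> A \<and> x * y \<in> A)"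

lemma unital_subringD:
  assumes "unital_subring A"
  shows unital_subring_1: "1 \<in> A"
    and unital_subring_diff: "\<And>x y. x \<in> A \<Longrightarrow> y \<in> A \<Longrightarrow> x - y \<in> A"
    and unital_subring_mult: "\<And>x y. x \<in> A \<Longrightarrow> y \<in> A \<Longrightarrow> x * y \<in> A"
  using assms by (auto simp: unital_subring_def)

lemma unital_subring_0: "unital_subring A \<Longrightarrow> 0 \<in> A"
  using unital_subring_diff[of A 1 1] unital_subring_1[of A] by simp

lemma unital_subring_uminus: "unital_subring A \<Longrightarrow> x \<in> A \<Longrightarrow> - x \<in> A"
  using unital_subring_diff[of A 0 x] unital_subring_0[of A] by simp

lemma unital_subring_add: "unital_subring A \<Longrightarrow> x \<in> A \<Longrightarrow> y \<in> A \<Longrightarrow> x + y \<in> A"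
  using unital_subring_diff[of A x "- y"] unital_subring_uminus[of A y] by simp

lemma unital_subring_power: "unital_subring A \<Longrightarrow> x \<in> A \<Longrightarrow> x ^ n \<in> A"
  by (induction n) (auto intro: unital_subring_1 unital_subring_mult)

lemma unital_subring_sum:
  "unital_subring A \<Longrightarrow> (\<And>i. i \<in> I \<Longrightarrow> f i \<in> A) \<Longrightarrow> sum f I \<in> A"
  by (induction I rule: infinite_finite_induct)
     (auto intro: unital_subring_0 unital_subring_add)

lemma unital_subring_of_int:
  assumes "unital_subring A" shows "of_int k \<in> A"
proof -
  have nat: "of_nat n \<in> A" for n
    by (induction n) (auto intro: assms unital_subring_0 unital_subring_1 unital_subring_add)
  show ?thesis
    by (cases k) (auto intro: assms unital_subring_uminus nat simp del: of_nat_Suc)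
qed

lemmas unital_subring_intros =
  unital_subring_0 unital_subring_1 unital_subring_diff unital_subring_mult
  unital_subring_uminus unital_subring_add unital_subring_power unital_subring_sum
  unital_subring_of_int

definition adjoin :: "'a::comm_ring_1 set \<Rightarrow> 'a \<Rightarrow> 'a set" where
  "adjoin A x = {poly q x | q. \<forall>i. coeff q i \<in> A}"

lemma unital_subring_adjoin:
  assumes "unital_subring A"
  shows "unital_subring (adjoin A x)"
  unfolding unital_subring_def
proof (intro conjI ballI)
  show "1 \<in> adjoin A x"
    unfolding adjoin_def using assms
    by (intro CollectI exI[of _ 1]) (auto simp: coeff_1 intro: unital_subring_intros)
  fix y z assume "y \<in> adjoin A x" "z \<in> adjoin A x"
  then obtain q r where q: "y = poly q x" "\<And>i. coeff q i \<in> A"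
    and r: "z = poly r x" "\<And>i. coeff r i \<in> A"
    by (auto simp: adjoin_def)
  show "y - z \<in> adjoin A x"
    unfolding adjoin_def using assms q r
    by (intro CollectI exI[of _ "q - r"]) (auto intro: unital_subring_intros)
  show "y * z \<in> adjoin A x"
    unfolding adjoin_def using assms q r
    by (intro CollectI exI[of _ "q * r"]) (auto simp: coeff_mult intro!: unital_subring_intros)
qed

lemma subset_adjoin:
  assumes "unital_subring A"
  shows "A \<subseteq> adjoin A x"
proof
  fix a assume "a \<in> A"
  then show "a \<in> adjoin A x"
    unfolding adjoin_def using assms
    by (intro CollectI exI[of _ "[:a:]"])
       (auto simp: coeff_pCons intro: unital_subring_intros split: nat.split)
qed

lemma in_adjoin:
  assumes "unital_subring A"
  shows "x \<in> adjoin A x"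
  unfolding adjoin_def using assms
  by (intro CollectI exI[of _ "[:0, 1:]"])
     (auto simp: coeff_pCons intro: unital_subring_intros split: nat.split)

text \<open>The valuation property is not assumed: it is derived from maximality in
  \<open>valuation_ring_dichotomy\<close>.\<close>

locale maximal_subring_avoiding =
  fixes p :: nat and A :: "'a::field_char_0 set"
  assumes prime: "prime p"
    and subring: "unital_subring A"
    and avoids: "1 / of_nat p \<notin> A"
    and maximal: "\<And>B. unital_subring B \<Longrightarrow> A \<subseteq> B \<Longrightarrow> 1 / of_nat p \<notin> B \<Longrightarrow> B = A"

text \<open>Zorn's lemma, starting from the integers. A union of a nonempty chain is again a subring
  because any two of its elements lie in a common member.\<close>

lemma maximal_subring_avoiding_exists:
  assumes "prime p"
  obtains A :: "'a::field_char_0 set" where "maximal_subring_avoiding p A"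
proof -
  let ?S = "{A :: 'a set. unital_subring A \<and> 1 / of_nat p \<notin> A}"
  have p0: "p > 1" using assms by (rule prime_gt_1_nat)
  have "(\<int> :: 'a set) \<in> ?S"
  proof -
    have "1 / of_nat p \<noteq> (of_int k :: 'a)" for k
    proof
      assume "1 / of_nat p = (of_int k :: 'a)"
      then have "(of_int (k * int p) :: 'a) = of_int 1" using p0 by (simp add: field_simps)
      then have "k * int p = 1" by (simp only: of_int_eq_iff)
      then show False using p0 zmult_eq_1_iff by force
    qed
    then show ?thesis
      by (auto simp: unital_subring_def elim: Ints_cases)
  qed
  moreover have "\<Union>\<C> \<in> ?S" if "\<C> \<noteq> {}" "subset.chain ?S \<C>" for \<C>
  proof -
    have mem: "\<And>A. A \<in> \<C> \<Longrightarrow> A \<in> ?S"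
      and tot: "\<And>A B. A \<in> \<C> \<Longrightarrow> B \<in> \<C> \<Longrightarrow> A \<subseteq> B \<or> B \<subseteq> A"
      using that by (auto simp: subset_chain_def)
    have "unital_subring (\<Union>\<C>)"
      unfolding unital_subring_def
    proof (intro conjI ballI)
      show "1 \<in> \<Union>\<C>" using that(1) mem by (auto intro: unital_subring_1)
      fix x y assume "x \<in> \<Union>\<C>" "y \<in> \<Union>\<C>"
      then obtain A B where "A \<in> \<C>" "B \<in> \<C>" "x \<in> A" "y \<in> B" by auto
      with tot obtain C where C: "C \<in> \<C>" "x \<in> C" "y \<in> C" by blast
      then show "x - y \<in> \<Union>\<C>" "x * y \<in> \<Union>\<C>"
        using mem[OF C(1)] by (auto intro: unital_subring_diff unital_subring_mult)
    qed
    then show ?thesis using mem by auto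
  qed
  ultimately obtain M where M: "M \<in> ?S" "\<And>X. X \<in> ?S \<Longrightarrow> M \<subseteq> X \<Longrightarrow> X = M"
    using subset_Zorn_nonempty[of ?S] by (metis (lifting) empty_iff)
  show ?thesis
    by (rule that[of M], unfold_locales) (use M assms in auto)
qed

context maximal_subring_avoiding
begin

section \<open>Units of \<open>A\<close> and the valuation ring property\<close>

lemma p_nonzero: "(of_nat p :: 'a) \<noteq> 0"
  using prime by auto

lemma p_in: "of_nat p \<in> A"
  using unital_subring_of_int[OF subring, of "int p"] by simp

text \<open>The ring \<open>adjoin A x\<close> is strictly larger than \<open>A\<close>, so by
  maximality it cannot avoid 1/p.\<close>

lemma inverse_p_in_adjoin:
  assumes "x \<notin> A"
  shows "1 / of_nat p \<in> adjoin A x"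
  using maximal[OF unital_subring_adjoin[OF subring, of x] subset_adjoin[OF subring]]
    in_adjoin[OF subring, of x] assms by auto

text \<open>If u = 1 - p b were not a unit, then u^n would be divisible by p for some n, although it is
  1 modulo p.\<close>

lemma unit_one_minus:
  assumes b: "b \<in> A"
  shows "1 - of_nat p * b \<noteq> 0" and "1 / (1 - of_nat p * b) \<in> A"
proof -
  define u where "u = 1 - of_nat p * b"
  have uA: "u \<in> A" unfolding u_def using b p_in subring by (intro unital_subring_intros)
  show nz: "1 - of_nat p * b \<noteq> 0"
  proof
    assume "1 - of_nat p * b = 0"
    then have "1 / of_nat p = b" using p_nonzero by (simp add: field_simps)
    then show False using b avoids by simp
  qed
  have pow: "\<exists>c\<in>A. u ^ n = 1 - of_nat p * c" for n
  proof (induction n)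
    case 0 show ?case using unital_subring_0[OF subring] by (intro bexI[of _ 0]) auto
  next
    case (Suc n)
    then obtain c where c: "c \<in> A" "u ^ n = 1 - of_nat p * c" by blast
    have "u ^ Suc n = 1 - of_nat p * (b + c * u)"
      unfolding power_Suc c(2) by (simp add: u_def algebra_simps)
    moreover have "b + c * u \<in> A" using b c uA subring by (intro unital_subring_intros)
    ultimately show ?case by blast
  qed
  have "1 / u \<in> A"
  proof (rule ccontr)
    assume "1 / u \<notin> A"
    from inverse_p_in_adjoin[OF this] obtain q
      where q: "1 / of_nat p = poly q (1 / u)" "\<And>i. coeff q i \<in> A" by (auto simp: adjoin_def)
    \<comment> \<open>Multiplying 1/p = q(1/u) by \<open>u ^ n\<close> clears the powers of 1/u, so
      that \<open>u ^ n\<close> / p equals the element \<open>d\<close> of \<open>A\<close>.\<close>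
    define n where "n = degree q"
    define d where "d = (\<Sum>i\<le>n. coeff q i * u ^ (n - i))"
    have un: "u \<noteq> 0" using nz u_def by simp
    have dA: "d \<in> A" unfolding d_def using q uA subring by (intro unital_subring_intros)
    have "u ^ n / of_nat p = u ^ n * poly q (1 / u)" using q(1) by (metis times_divide_eq_right mult.right_neutral)
    also have "\<dots> = d" unfolding poly_altdef d_def n_def sum_distrib_left
      using un by (intro sum.cong refl) (simp add: power_diff power_one_over field_simps)
    finally have eq: "u ^ n / of_nat p = d" .
    from pow[of n] obtain c where c: "c \<in> A" "u ^ n = 1 - of_nat p * c" by blast
    have "1 / of_nat p = d + c" using eq c(2) p_nonzero by (simp add: field_simps)
    then show False using avoids dA c(1) unital_subring_add[OF subring] by simp
  qed
  then show "1 / (1 - of_nat p * b) \<in> A" by (simp add: u_def)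
qed

text \<open>Membership of 1/p in \<open>adjoin A x\<close> with a bound on the degree recorded, as
  needed for a descent on that bound.\<close>

definition expressible :: "'a \<Rightarrow> nat \<Rightarrow> bool" where
  "expressible x n \<longleftrightarrow> (\<exists>a. (\<forall>i. a i \<in> A) \<and> 1 / of_nat p = (\<Sum>i\<le>n. a i * x ^ i))"

lemma expressible_mono:
  assumes "expressible x m" "m \<le> n" shows "expressible x n"
proof -
  obtain a where a: "\<And>i. a i \<in> A" "1 / of_nat p = (\<Sum>i\<le>m. a i * x ^ i)"
    using assms(1) by (auto simp: expressible_def)
  let ?b = "\<lambda>i. if i \<le> m then a i else 0"
  have "(\<Sum>i\<le>n. ?b i * x ^ i) = (\<Sum>i\<le>m. a i * x ^ i)"
    using assms(2) by (intro sum.mono_neutral_cong_right) auto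
  then show ?thesis unfolding expressible_def using a unital_subring_0[OF subring]
    by (intro exI[of _ ?b]) auto
qed

text \<open>Since 1 - p b(0) is a unit, the second relation rewrites the leading term of the first one in
  terms of lower powers of x.\<close>

lemma expressible_lower:
  assumes "x \<noteq> 0" "expressible x (Suc n)" "expressible (1 / x) (Suc n)"
  shows "expressible x n"
proof -
  let ?N = "Suc n"
  obtain a where a: "\<And>i. a i \<in> A" "1 / of_nat p = (\<Sum>i\<le>?N. a i * x ^ i)"
    using assms(2) by (auto simp: expressible_def)
  obtain b where b: "\<And>i. b i \<in> A" "1 / of_nat p = (\<Sum>i\<le>?N. b i * (1 / x) ^ i)"
    using assms(3) by (auto simp: expressible_def)
  define u where "u = 1 - of_nat p * b 0"
  have u: "u \<noteq> 0" "1 / u \<in> A" using unit_one_minus[OF b(1)] by (auto simp: u_def)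
  \<comment> \<open>Moving \<open>b 0\<close> to the left in the second relation and multiplying by
    p x^N / u gives x^N = (p/u) * (sum of b(N-i) x^i over i < N). The \<open>c i\<close> are the
    coefficients after substituting this for x^N in the first relation.\<close>
  define c where "c i = a i + of_nat p * a ?N * b (?N - i) * (1 / u)" for i
  have cA: "c i \<in> A" for i
    unfolding c_def using a b u p_in subring by (intro unital_subring_intros)
  have "(\<Sum>i<?N. b (?N - i) * x ^ i) = (\<Sum>j<?N. b (Suc j) * x ^ (?N - Suc j))"
    by (subst sum.nat_diff_reindex[symmetric]) (intro sum.cong, auto simp: Suc_diff_Suc)
  also have "\<dots> = x ^ ?N * (\<Sum>j<?N. b (Suc j) * (1 / x) ^ Suc j)"
    unfolding sum_distrib_left using assms(1)
    by (intro sum.cong refl) (simp add: power_diff power_one_over field_simps)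
  also have "(\<Sum>j<?N. b (Suc j) * (1 / x) ^ Suc j) = 1 / of_nat p - b 0"
    unfolding b(2) sum.atMost_shift by simp
  also have "\<dots> = u / of_nat p" using p_nonzero by (simp add: u_def field_simps)
  finally have key: "(\<Sum>i<?N. b (?N - i) * x ^ i) = x ^ ?N * (u / of_nat p)" .
  have "(\<Sum>i<?N. c i * x ^ i) =
      (\<Sum>i<?N. a i * x ^ i) + of_nat p * a ?N / u * (\<Sum>i<?N. b (?N - i) * x ^ i)"
    unfolding c_def by (simp add: algebra_simps sum.distrib sum_distrib_left)
  also have "\<dots> = (\<Sum>i<?N. a i * x ^ i) + a ?N * x ^ ?N"
    unfolding key using u p_nonzero by simp
  also have "\<dots> = 1 / of_nat p" unfolding a(2) by (simp add: lessThan_Suc_atMost)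
  finally show ?thesis unfolding expressible_def lessThan_Suc_atMost using cA by metis
qed

text \<open>Descent on n + m: the relation of smaller degree is padded with zeros to the degree of
  the other one, which \<open>expressible_lower\<close> then shortens. Degree 0 cannot occur because
  1/p is not in \<open>A\<close>.\<close>

lemma not_expressible_both:
  assumes "x \<noteq> 0" "expressible x n" "expressible (1 / x) m"
  shows False
  using assms
proof (induction "n + m" arbitrary: x n m rule: less_induct)
  case less
  have no0: "\<not> expressible y 0" for y
    using avoids by (auto simp: expressible_def)
  show False
  proof (cases "m \<le> n")
    case True
    with less.prems no0 obtain n' where n': "n = Suc n'" by (cases n) auto
    then have "expressible x n'"
      using expressible_lower[OF less.prems(1)] less.prems(2) expressible_mono[OF less.prems(3) True]
      by simp
    then show False using less.hyps[of n' m x] less.prems n' by simp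
  next
    case False
    with less.prems no0 obtain m' where m': "m = Suc m'" by (cases m) auto
    then have "expressible (1 / x) m'"
      using expressible_lower[of "1 / x" m'] less.prems(1,3) expressible_mono[OF less.prems(2), of m] False
      by simp
    then show False using less.hyps[of n m' x] less.prems m' by simp
  qed
qed

text \<open>If both failed, 1/p would be a polynomial over \<open>A\<close> in x and also one in
  1/x, which the descent excludes.\<close>

lemma valuation_ring_dichotomy:
  assumes "x \<noteq> 0"
  shows "x \<in> A \<or> 1 / x \<in> A"
proof -
  have "\<exists>n. expressible y n" if "y \<notin> A" for y
    using inverse_p_in_adjoin[OF that] unfolding adjoin_def expressible_def
    by (auto simp: poly_altdef)
  then show ?thesis using not_expressible_both[OF assms] by blast
qed

text \<open>Bezout gives a u = 1 - p b with integers a and b, and the right-hand side is a unit of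
  \<open>A\<close>.\<close>

lemma inverse_coprime_in:
  assumes "coprime u (int p)"
  shows "1 / of_int u \<in> A"
proof -
  obtain a b where ab: "a * u + b * int p = 1"
    using bezout_int[of u "int p"] assms by auto
  then have "(of_int (a * u + b * int p) :: 'a) = 1" by simp
  then have eq: "of_int a * of_int u = (1 - of_nat p * of_int b :: 'a)"
    by (simp add: algebra_simps)
  have bA: "of_int b \<in> A" by (rule unital_subring_of_int[OF subring])
  have "(of_int u :: 'a) \<noteq> 0" "(of_int a :: 'a) \<noteq> 0" using eq unit_one_minus(1)[OF bA] by auto
  then have "1 / of_int u = of_int a * (1 / (1 - of_nat p * of_int b) :: 'a)"
    unfolding eq[symmetric] by simp
  then show ?thesis
    using unital_subring_mult[OF subring unital_subring_of_int[OF subring] unit_one_minus(2)[OF bA]]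
    by simp
qed

text \<open>An integer polynomial c + X r(X) of least degree vanishing at x has c nonzero, since
  otherwise r would be a smaller choice. Then c / x = - r(x) lies in \<open>A\<close>, and c is a
  power of p times an integer prime to p, which is a unit of \<open>A\<close>.\<close>

lemma power_p_mult_in:
  assumes "algebraic x" "x \<in> A" "x \<noteq> 0"
  shows "\<exists>k. of_nat p ^ k * (1 / x) \<in> A"
proof -
  let ?P = "\<lambda>q. (\<forall>i. coeff q i \<in> \<int>) \<and> q \<noteq> 0 \<and> poly q x = 0"
  obtain q0 where "?P q0" using assms(1) unfolding algebraic_def by blast
  from ex_has_least_nat[of ?P, OF this, of degree] obtain q
    where q: "?P q" and least: "\<And>r. ?P r \<Longrightarrow> degree q \<le> degree r" by blast
  obtain c r where qr: "q = pCons c r" by (cases q)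
  have rint: "coeff r i \<in> \<int>" for i
    using spec[OF conjunct1[OF q], of "Suc i"] unfolding qr by simp
  have c0: "c \<noteq> 0"
  proof
    assume "c = 0"
    then have "?P r" "degree r < degree q" using q qr rint assms(3) by auto
    then show False using least[of r] by simp
  qed
  have "c \<in> \<int>" using spec[OF conjunct1[OF q], of 0] unfolding qr by simp
  then obtain m where m: "c = of_int m" by (elim Ints_cases)
  have m0: "m \<noteq> 0" using c0 m by simp
  have "coeff r i \<in> A" for i
    using rint[of i] unital_subring_of_int[OF subring] by (auto elim!: Ints_cases)
  then have rA: "poly r x \<in> A" unfolding poly_altdef using assms(2)
    by (intro unital_subring_sum unital_subring_mult unital_subring_power subring)
  have "c / x = - poly r x" using q assms(3) unfolding qr by (simp add: field_simps add_eq_0_iff)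
  then have cA: "c / x \<in> A" using rA subring by (simp add: unital_subring_uminus)
  have "\<not> is_unit (int p)" using prime by auto
  then obtain u where u: "m = int p ^ multiplicity (int p) m * u" "\<not> int p dvd u"
    using multiplicity_decompose'[of m "int p"] m0 by blast
  define k where "k = multiplicity (int p) m"
  have "prime (int p)" using prime by simp
  then have "coprime u (int p)"
    using u(2) prime_imp_coprime[of "int p" u] by (simp add: coprime_commute)
  then have uA: "1 / of_int u \<in> A" by (rule inverse_coprime_in)
  have "u \<noteq> 0" using u m0 by auto
  moreover have "c = of_nat p ^ k * of_int u" unfolding m k_def by (subst u(1)) simp
  ultimately have "of_nat p ^ k * (1 / x) = c / x * (1 / of_int u)" by simp
  then have "of_nat p ^ k * (1 / x) \<in> A" using unital_subring_mult[OF subring cA uA] by simp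
  then show ?thesis by blast
qed

end

section \<open>Absolute values above a prime\<close>

locale maximal_subring_algebraic = maximal_subring_avoiding p A
  for p :: nat and A :: "'a::field_char_0 set" +
  assumes algebraic: "\<And>x :: 'a. algebraic x"
begin

text \<open>This is the rank one property. For x outside \<open>A\<close>, the inverse 1/x lies in
  \<open>A\<close>, and \<open>power_p_mult_in\<close> applies to it.\<close>

lemma archimedean: "\<exists>k. of_nat p ^ k * x \<in> A"
proof (cases "x \<in> A")
  case True
  then show ?thesis by (intro exI[of _ 0]) simp
next
  case False
  then have "x \<noteq> 0" using unital_subring_0[OF subring] by auto
  then have "1 / x \<in> A" using valuation_ring_dichotomy[of x] False by blast
  then show ?thesis using power_p_mult_in[OF algebraic, of "1 / x"] \<open>x \<noteq> 0\<close> by simp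
qed

lemma power_int_p_in_imp:
  assumes "of_nat p powi k \<in> A" shows "k \<ge> 0"
proof (rule ccontr)
  assume "\<not> k \<ge> 0"
  then have k: "- k - 1 \<ge> 0" by simp
  \<comment> \<open>The exponent - k - 1 is the one that leaves exactly 1/p after multiplication by
    the k-th power of p.\<close>
  have "of_nat p ^ nat (- k - 1) * of_nat p powi k \<in> A"
    using assms p_in subring by (intro unital_subring_intros)
  also have "of_nat p ^ nat (- k - 1) = (of_nat p :: 'a) powi (- k - 1)"
    using k by (simp add: power_int_def)
  also have "\<dots> * of_nat p powi k = 1 / of_nat p"
    using p_nonzero by (subst power_int_add[symmetric]) (auto simp: field_simps)
  finally show False using avoids by simp
qed

text \<open>For a real valuation v with ring \<open>A\<close> and v(p) = 1, the condition on k and m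
  would say k <= m v(x). The slopes are thus the rational lower bounds of the value to be
  constructed; k may be negative, which serves the x outside \<open>A\<close>.\<close>

definition slopes :: "'a \<Rightarrow> real set" where
  "slopes x = {real_of_int k / real m | k m. m > 0 \<and> x ^ m * of_nat p powi (- k) \<in> A}"

lemma slopesI:
  "m > 0 \<Longrightarrow> x ^ m * of_nat p powi (- k) \<in> A \<Longrightarrow> real_of_int k / real m \<in> slopes x"
  unfolding slopes_def by blast

text \<open>Over the common denominator m n, the required element of \<open>A\<close> is the n-th
  power of the element for x times the m-th power of the element for y.\<close>

lemma slopes_mult:
  assumes "a \<in> slopes x" "b \<in> slopes y"
  shows "a + b \<in> slopes (x * y)"
proof -
  obtain k m where a: "a = real_of_int k / real m" "m > 0" "x ^ m * of_nat p powi (- k) \<in> A"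
    using assms(1) unfolding slopes_def by blast
  obtain l n where b: "b = real_of_int l / real n" "n > 0" "y ^ n * of_nat p powi (- l) \<in> A"
    using assms(2) unfolding slopes_def by blast
  let ?P = "of_nat p :: 'a"
  have "?P powi (- (k * int n + l * int m)) = (?P powi (- k)) ^ n * (?P powi (- l)) ^ m"
    using p_nonzero
    by (simp flip: power_int_of_nat power_int_mult add: power_int_add power_int_diff power_int_minus field_simps)
  then have "(x * y) ^ (m * n) * ?P powi (- (k * int n + l * int m)) =
      (x ^ m * ?P powi (- k)) ^ n * (y ^ n * ?P powi (- l)) ^ m"
    by (simp add: power_mult_distrib power_mult[symmetric] mult_ac)
  also have "\<dots> \<in> A"
    by (rule unital_subring_mult[OF subring unital_subring_power[OF subring a(3)]
          unital_subring_power[OF subring b(3)]])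
  finally have "real_of_int (k * int n + l * int m) / real (m * n) \<in> slopes (x * y)"
    using a b by (intro slopesI) auto
  moreover have "real_of_int (k * int n + l * int m) / real (m * n) = a + b"
    using a b by (simp add: field_simps)
  ultimately show ?thesis by simp
qed

lemma zero_in_slopes: "x \<in> A \<Longrightarrow> 0 \<in> slopes x"
  using slopesI[of 1 x 0] by simp

lemma one_in_slopes_p: "1 \<in> slopes (of_nat p)"
  using slopesI[of 1 "of_nat p" 1] p_nonzero unital_subring_1[OF subring] by simp

lemma slopes_1_nonpos: "a \<in> slopes 1 \<Longrightarrow> a \<le> 0"
  using power_int_p_in_imp unfolding slopes_def by (fastforce simp: divide_nonpos_pos)

lemma slopes_nonempty: "slopes x \<noteq> {}"
proof -
  obtain k where "of_nat p ^ k * x \<in> A" using archimedean by blast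
  then have "real_of_int (- int k) / real 1 \<in> slopes x"
    by (intro slopesI) (auto simp: mult.commute)
  then show ?thesis by blast
qed

text \<open>A slope a of x and a fixed slope b of 1/x add up to a slope of 1, which is at most 0; so
  - b is an upper bound.\<close>

lemma slopes_bdd_above:
  assumes "x \<noteq> 0" shows "bdd_above (slopes x)"
proof -
  obtain b where "b \<in> slopes (1 / x)" using slopes_nonempty by blast
  then have "a \<le> - b" if "a \<in> slopes x" for a
    using slopes_1_nonpos slopes_mult[OF that, of b "1 / x"] assms by force
  then show ?thesis by (rule bdd_aboveI)
qed

text \<open>For q = k/m this is the valuation ring dichotomy for x^m / p^k. It makes the slopes of x
  and of 1/x complementary, whence \<open>val_inverse_ge\<close>.\<close>

lemma slopes_dichotomy:
  assumes "x \<noteq> 0" "q \<in> \<rat>" shows "q \<in> slopes x \<or> - q \<in> slopes (1 / x)"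
proof -
  obtain k m where q: "q = real_of_int k / real m" "m \<noteq> 0"
    using assms(2) unfolding Rats_eq_int_div_nat by blast
  let ?z = "x ^ m * of_nat p powi (- k)"
  have inv: "1 / ?z = (1 / x) ^ m * of_nat p powi (- (- k))"
    using p_nonzero assms by (simp add: power_int_minus field_simps)
  have "?z \<noteq> 0" using p_nonzero assms by simp
  then have "?z \<in> A \<or> 1 / ?z \<in> A" by (rule valuation_ring_dichotomy)
  then show ?thesis
  proof
    assume "?z \<in> A"
    then show ?thesis using slopesI q by simp
  next
    assume "1 / ?z \<in> A"
    then have "real_of_int (- k) / real m \<in> slopes (1 / x)"
      unfolding inv using q by (intro slopesI) auto
    then show ?thesis using q by simp
  qed
qed

text \<open>Meaningful only for nonzero x: every rational is a slope of 0, so \<open>abs_val\<close>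
  treats 0 separately.\<close>

definition val :: "'a \<Rightarrow> real" where
  "val x = Sup (slopes x)"

lemma slope_le_val: "x \<noteq> 0 \<Longrightarrow> a \<in> slopes x \<Longrightarrow> a \<le> val x"
  unfolding val_def by (intro cSup_upper slopes_bdd_above)

lemma val_mult_ge:
  assumes "x \<noteq> 0" "y \<noteq> 0"
  shows "val x + val y \<le> val (x * y)"
proof -
  have le: "a + b \<le> val (x * y)" if "a \<in> slopes x" "b \<in> slopes y" for a b
    using slope_le_val[of "x * y"] slopes_mult[OF that] assms by simp
  \<comment> \<open>The supremum is taken in one factor at a time, first over the slopes of y with a
    fixed.\<close>
  have "val y \<le> val (x * y) - a" if "a \<in> slopes x" for a
    unfolding val_def[of y] using le[OF that] slopes_nonempty
    by (intro cSup_least) (auto simp: le_diff_eq add.commute)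
  then have "val x \<le> val (x * y) - val y"
    unfolding val_def[of x] using slopes_nonempty
    by (intro cSup_least) (force simp: le_diff_eq add.commute)+
  then show ?thesis by simp
qed

text \<open>A rational q strictly between \<open>val x\<close> and \<open>- val (1 / x)\<close>
  would contradict the dichotomy, being too large for a slope of x, with - q too large for a slope
  of 1/x.\<close>

lemma val_inverse_ge:
  assumes "x \<noteq> 0" shows "- val x \<le> val (1 / x)"
proof (rule ccontr)
  assume "\<not> - val x \<le> val (1 / x)"
  then have "val x < - val (1 / x)" by simp
  then obtain q where q: "q \<in> \<rat>" "val x < q" "q < - val (1 / x)"
    using Rats_dense_in_real by blast
  then show False
    using slopes_dichotomy[OF assms q(1)] slope_le_val[of x q] slope_le_val[of "1 / x" "- q"] assms
    by auto
qed

text \<open>The missing inequality is superadditivity for the product of 1/x and x y.\<close>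

lemma val_mult:
  assumes "x \<noteq> 0" "y \<noteq> 0" shows "val (x * y) = val x + val y"
proof (rule antisym)
  have "val (1 / x) + val (x * y) \<le> val y"
    using val_mult_ge[of "1 / x" "x * y"] assms by simp
  then show "val (x * y) \<le> val x + val y" using val_inverse_ge[OF assms(1)] by simp
qed (rule val_mult_ge[OF assms])

lemma val_nonneg: "x \<in> A \<Longrightarrow> x \<noteq> 0 \<Longrightarrow> 0 \<le> val x"
  by (intro slope_le_val zero_in_slopes)

text \<open>By the dichotomy one of y/x and x/y lies in \<open>A\<close>. In the first case x + y =
  x (1 + y/x), whose second factor has nonnegative value; the other case is symmetric.\<close>

lemma val_add:
  assumes "x \<noteq> 0" "y \<noteq> 0" "x + y \<noteq> 0" shows "min (val x) (val y) \<le> val (x + y)"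
proof -
  have *: "val x \<le> val (x + y)" if "y / x \<in> A" "x \<noteq> 0" "x + y \<noteq> 0" for x y
  proof -
    have z: "1 + y / x \<in> A" "1 + y / x \<noteq> 0"
      using unital_subring_add[OF subring unital_subring_1[OF subring] that(1)] that(2,3)
      by (auto simp: field_simps)
    have "val (x + y) = val (x * (1 + y / x))" using that by (simp add: distrib_left)
    also have "\<dots> = val x + val (1 + y / x)" using that z by (intro val_mult)
    finally show ?thesis using val_nonneg[OF z] by simp
  qed
  have "y / x \<in> A \<or> x / y \<in> A" using valuation_ring_dichotomy[of "y / x"] assms by simp
  then show ?thesis using *[of y x] *[of x y] assms by (auto simp: add.commute)
qed

definition abs_val :: "'a \<Rightarrow> real" where
  "abs_val x = (if x = 0 then 0 else 2 powr (- val x))"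

text \<open>The triangle inequality follows from the ultrametric one. The bounds at integers and at
  p, which come from integers lying in \<open>A\<close> and from the slope 1 of p, will separate the
  places of different primes.\<close>

lemma shows absolute_value_abs_val: "absolute_value abs_val"
    and abs_val_add: "abs_val (x + y) \<le> max (abs_val x) (abs_val y)"
    and abs_val_of_int: "abs_val (of_int k) \<le> 1"
    and abs_val_p: "abs_val (of_nat p) < 1"
proof -
  have add: "abs_val (x + y) \<le> max (abs_val x) (abs_val y)" for x y
  proof (cases "x = 0 \<or> y = 0 \<or> x + y = 0")
    case True
    then show ?thesis by (auto simp: abs_val_def le_max_iff_disj)
  next
    case False
    then have "min (val x) (val y) \<le> val (x + y)" by (intro val_add) auto
    then show ?thesis using False by (auto simp: abs_val_def le_max_iff_disj min_le_iff_disj)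
  qed
  then show "abs_val (x + y) \<le> max (abs_val x) (abs_val y)" .
  have nonneg: "abs_val x \<ge> 0" for x by (simp add: abs_val_def)
  show "absolute_value abs_val"
    unfolding absolute_value_def
  proof (intro conjI allI)
    fix x y
    show "abs_val (x * y) = abs_val x * abs_val y"
      by (simp add: abs_val_def val_mult flip: powr_add)
    show "abs_val (x + y) \<le> abs_val x + abs_val y"
      using add[of x y] nonneg[of x] nonneg[of y] by linarith
  qed (auto simp: abs_val_def)
  have "2 powr (- a) \<le> 1" if "a \<ge> 0" for a :: real
    using powr_mono[of "- a" 0 2] that by simp
  then show "abs_val (of_int k) \<le> 1"
    using val_nonneg[OF unital_subring_of_int[OF subring, of k]] by (auto simp: abs_val_def)
  have "1 \<le> val (of_nat p)" using slope_le_val[OF p_nonzero one_in_slopes_p] .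
  then show "abs_val (of_nat p) < 1"
    using powr_less_mono[of "- val (of_nat p)" 0 2] by (auto simp: abs_val_def)
qed

end

text \<open>With n the size of a spanning set, the n + 1 powers of x up to x^n satisfy a nontrivial
  linear relation over the rationals.\<close>

lemma number_field_algebraic:
  fixes x :: "'a::field_char_0"
  assumes "number_field TYPE('a)"
  shows "algebraic x"
proof -
  interpret vs: vector_space "\<lambda>q (x :: 'a). of_rat q * x"
    by unfold_locales (auto simp: algebra_simps of_rat_add of_rat_mult)
  obtain B :: "'a set" where B: "finite B" "vs.span B = UNIV"
    using assms unfolding number_field_def by blast
  define n where "n = card B"
  show ?thesis
  \<comment> \<open>Coinciding powers form a set too small for the dimension bound, but then x is a
    root of X^j - X^i.\<close>
  proof (cases "inj_on (\<lambda>i. x ^ i) {..n}")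
    case False
    then obtain i j where ij: "i < j" "x ^ i = x ^ j"
      unfolding inj_on_def by (metis linorder_neqE_nat)
    let ?q = "monom 1 j - monom 1 i :: 'a poly"
    have "coeff ?q j \<noteq> 0" using ij by simp
    then have "?q \<noteq> 0" by (metis coeff_0)
    moreover have "coeff ?q k \<in> \<rat>" for k by simp
    moreover have "poly ?q x = 0" using ij by (simp add: poly_monom)
    ultimately show ?thesis unfolding algebraic_altdef by blast
  next
    case True
    let ?S = "(\<lambda>i. x ^ i) ` {..n}"
    have "card ?S = Suc n" using True by (simp add: card_image)
    then have "vs.dependent ?S"
      using vs.independent_span_bound[OF B(1), of ?S] B(2) by (auto simp: n_def)
    then obtain u where u: "\<exists>v\<in>?S. u v \<noteq> 0" "(\<Sum>v\<in>?S. of_rat (u v) * v) = 0"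
      using vs.dependent_finite[of ?S] by auto
    define q where "q = (\<Sum>i\<le>n. monom (of_rat (u (x ^ i))) i :: 'a poly)"
    have cq: "coeff q k = (if k \<le> n then of_rat (u (x ^ k)) else 0)" for k
      unfolding q_def by (simp add: coeff_sum)
    obtain k where k: "k \<le> n" "u (x ^ k) \<noteq> 0" using u(1) by auto
    have "coeff q k \<noteq> 0" using k cq by simp
    then have "q \<noteq> 0" by (metis coeff_0)
    moreover have "coeff q k \<in> \<rat>" for k by (simp add: cq)
    moreover have "poly q x = 0"
      using u(2) True by (simp add: q_def poly_sum poly_monom sum.reindex)
    ultimately show ?thesis unfolding algebraic_altdef by blast
  qed
qed

lemma number_field_abs_above_prime:
  assumes "number_field TYPE('a::field_char_0)" "prime p"
  obtains f :: "'a::field_char_0 \<Rightarrow> real" where "absolute_value f" "\<And>x y. f (x + y) \<le> max (f x) (f y)"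
    "\<And>k. f (of_int k) \<le> 1" "f (of_nat p) < 1"
proof -
  obtain A :: "'a set" where A: "maximal_subring_avoiding p A"
    using maximal_subring_avoiding_exists[OF assms(2)] .
  interpret maximal_subring_algebraic p A
    using A number_field_algebraic[OF assms(1)]
    by (auto simp: maximal_subring_algebraic_def maximal_subring_algebraic_axioms_def)
  show ?thesis
    by (rule that[OF absolute_value_abs_val abs_val_add abs_val_of_int abs_val_p])
qed

section \<open>Places\<close>

lemma absolute_valueD:
  assumes "absolute_value f"
  shows absolute_value_nonneg: "0 \<le> f x"
    and absolute_value_eq_0: "f x = 0 \<longleftrightarrow> x = 0"
    and absolute_value_mult: "f (x * y) = f x * f y"
    and absolute_value_add: "f (x + y) \<le> f x + f y"
  using assms by (auto simp: absolute_value_def)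

lemma absolute_value_1: "absolute_value f \<Longrightarrow> f 1 = 1"
  using absolute_value_mult[of f 1 1] absolute_value_eq_0[of f 1] by simp

lemma absolute_value_minus:
  assumes "absolute_value f" shows "f (- x) = f x"
proof -
  have "f (- 1) * f (- 1) = 1"
    using absolute_value_mult[OF assms, of "- 1" "- 1"] absolute_value_1[OF assms] by simp
  then have "f (- 1) = 1"
    using absolute_value_nonneg[OF assms, of "- 1"] by (simp add: square_eq_1_iff)
  then show ?thesis using absolute_value_mult[OF assms, of "- 1" x] by simp
qed

lemma absolute_value_diff_le:
  assumes "absolute_value f" shows "\<bar>f (x + y) - f y\<bar> \<le> f x"
  using absolute_value_add[OF assms, of x y] absolute_value_add[OF assms, of "- x" "x + y"]
    absolute_value_minus[OF assms, of x] by simp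

lemma place_abs_in:
  assumes "v \<in> places" shows "place_abs v \<in> v"
proof -
  obtain f where f: "f \<in> nontrivial_absolute_values" "v = equivalent_absolute_values `` {f}"
    using assms unfolding places_def by (elim quotientE)
  have "f x = f x powr 1" for x
    using f(1) by (simp add: nontrivial_absolute_values_def absolute_value_nonneg)
  then have "f \<in> v"
    using f by (auto simp: equivalent_absolute_values_def intro!: exI[of _ 1])
  then show ?thesis unfolding place_abs_def by (rule someI[of "\<lambda>f. f \<in> v"])
qed

lemma absolute_value_place_abs:
  assumes "v \<in> places" shows "absolute_value (place_abs v)"
  using place_abs_in[OF assms] assms
  by (auto simp: places_def quotient_def equivalent_absolute_values_def nontrivial_absolute_values_def)

text \<open>Distinct primes p and q give distinct places: an absolute value below 1 at both and at
  most 1 on the integers would, by the ultrametric inequality and a p + b q = 1, be below 1 at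
  1.\<close>

lemma infinite_nonarchimedean_places:
  assumes "number_field TYPE('a::field_char_0)"
  shows "infinite {v \<in> places :: 'a place set. nonarchimedean v}"
proof -
  let ?ab = "\<lambda>p (f :: 'a \<Rightarrow> real). absolute_value f \<and> (\<forall>x y. f (x + y) \<le> max (f x) (f y)) \<and>
      (\<forall>k. f (of_int k) \<le> 1) \<and> f (of_nat p) < 1"
  have "\<exists>f. ?ab p f" if "prime p" for p
    using number_field_abs_above_prime[OF assms that] by metis
  then obtain F where F: "\<And>p. prime p \<Longrightarrow> ?ab p (F p)" by metis
  define V where "V p = equivalent_absolute_values `` {F p}" for p
  have nontriv: "F p \<in> nontrivial_absolute_values" if "prime p" for p
    using F[OF that] that by (auto simp: nontrivial_absolute_values_def intro!: exI[of _ "of_nat p"])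
  have place: "V p \<in> places" if "prime p" for p
    unfolding V_def places_def by (intro quotientI nontriv that)
  have powr: "\<exists>s>0. \<forall>x. g x = F p x powr s" if "g \<in> V p" for g p
    using that by (auto simp: V_def equivalent_absolute_values_def)
  have nonarch: "nonarchimedean (V p)" if p: "prime p" for p
  proof -
    \<comment> \<open>The predicate \<open>nonarchimedean\<close> speaks of the chosen
      representative, which is only known to be a positive power of \<open>F p\<close>; such powers
      preserve the ultrametric inequality.\<close>
    obtain s where s: "s > 0" "\<And>x. place_abs (V p) x = F p x powr s"
      using powr[OF place_abs_in[OF place[OF p]]] by blast
    have "F p (x + y) powr s \<le> max (F p x powr s) (F p y powr s)" for x y
    proof -
      have "F p (x + y) powr s \<le> max (F p x) (F p y) powr s"
        using F[OF p] s(1) by (intro powr_mono2) (auto simp: absolute_value_nonneg)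
      then show ?thesis by (auto simp: max_def split: if_splits)
    qed
    then show ?thesis by (simp add: nonarchimedean_def s)
  qed
  have "inj_on V {p. prime p}"
  proof (rule inj_onI, clarify, rule ccontr)
    fix p q :: nat assume p: "prime p" and q: "prime q" and eq: "V p = V q" and neq: "p \<noteq> q"
    have "F q \<in> V q"
      using nontriv[OF q] F[OF q]
      by (auto simp: V_def equivalent_absolute_values_def absolute_value_nonneg intro!: exI[of _ 1])
    then obtain s where s: "s > 0" "\<And>x. F q x = F p x powr s"
      using powr[of "F q" p] eq by auto
    have Fq: "absolute_value (F q)" using F[OF q] by simp
    \<comment> \<open>Being a positive power of \<open>F p\<close>, the absolute value
      \<open>F q\<close> is below 1 at p as well as at q.\<close>
    have "F q (of_nat p) < 1 powr s"
      unfolding s(2) using F[OF p] s(1) by (intro powr_less_mono2) (auto simp: absolute_value_nonneg)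
    then have lt: "F q (of_nat p) < 1" by simp
    have "coprime (int p) (int q)" using primes_coprime[OF p q neq] by simp
    then obtain a b where ab: "a * int p + b * int q = 1"
      using bezout_int[of "int p" "int q"] by auto
    then have "of_int a * of_nat p + of_int b * of_nat q = (1 :: 'a)"
      by (metis of_int_1 of_int_add of_int_mult of_int_of_nat_eq)
    then have "1 \<le> max (F q (of_int a * of_nat p)) (F q (of_int b * of_nat q))"
      using F[OF q] absolute_value_1[OF Fq] by metis
    moreover have "F q (of_int c * of_nat r) < 1" if "F q (of_nat r) < 1" for c r
    proof -
      have "F q (of_int c * of_nat r) \<le> 1 * F q (of_nat r)"
        unfolding absolute_value_mult[OF Fq]
        using F[OF q] absolute_value_nonneg[OF Fq] by (intro mult_right_mono) auto
      then show ?thesis using that by simp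
    qed
    ultimately show False using lt F[OF q] by (smt (verit))
  qed
  then have "infinite (V ` {p. prime p})"
    using primes_infinite by (simp add: finite_image_iff)
  then show ?thesis
    by (rule infinite_super[rotated]) (use place nonarch in auto)
qed

section \<open>Constants in the completions\<close>

text \<open>The canonical map of the field into its completion. The main argument applies it to 0, 1
  and -1.\<close>

definition embed :: "'a::field place \<Rightarrow> 'a \<Rightarrow> (nat \<Rightarrow> 'a) set" where
  "embed v c = null_ideal v +>\<^bsub>cauchy_ring v\<^esub> (\<lambda>_. c)"

lemma embed_eq: "embed v c = {\<lambda>n. s n + c | s. s \<in> null_ideal v}"
  by (auto simp: embed_def a_r_coset_def' cauchy_ring_def)

lemma const_in_null_ideal_iff:
  assumes "v \<in> places"
  shows "(\<lambda>_. c) \<in> null_ideal v \<longleftrightarrow> c = 0"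
proof -
  have av: "absolute_value (place_abs v)" using assms by (rule absolute_value_place_abs)
  have "place_abs v 0 = 0" using absolute_value_eq_0[OF av, of 0] by simp
  then have "(\<lambda>_. c) \<in> null_ideal v \<longleftrightarrow> place_abs v c = 0"
    by (simp add: null_ideal_def cauchy_ring_def tendsto_const_iff)
  then show ?thesis using absolute_value_eq_0[OF av] by simp
qed

text \<open>Constant sequences serve as test elements: they tell these cosets apart and pin down the
  limit in \<open>completion_abs_embed\<close>.\<close>

lemma const_in_embed_iff:
  assumes "v \<in> places"
  shows "(\<lambda>_. d) \<in> embed v c \<longleftrightarrow> d = c"
proof -
  have "(\<lambda>_. d) \<in> embed v c \<longleftrightarrow> (\<lambda>_. d - c) \<in> null_ideal v"
  proof
    assume "(\<lambda>_. d) \<in> embed v c"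
    then obtain s where s: "(\<lambda>_. d) = (\<lambda>n. s n + c)" "s \<in> null_ideal v" by (auto simp: embed_eq)
    have "s n = d - c" for n using fun_cong[OF s(1), of n] by simp
    then have "s = (\<lambda>_. d - c)" by (rule ext)
    then show "(\<lambda>_. d - c) \<in> null_ideal v" using s(2) by simp
  next
    assume "(\<lambda>_. d - c) \<in> null_ideal v"
    then show "(\<lambda>_. d) \<in> embed v c" unfolding embed_eq by force
  qed
  then show ?thesis using const_in_null_ideal_iff[OF assms] by simp
qed

lemma embed_inject: "v \<in> places \<Longrightarrow> embed v c = embed v d \<longleftrightarrow> c = d"
  using const_in_embed_iff by blast

lemma zero_completion_at: "\<zero>\<^bsub>completion_at v\<^esub> = embed v 0"
  by (simp add: completion_at_def FactRing_def embed_eq)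

lemma one_completion_at: "\<one>\<^bsub>completion_at v\<^esub> = embed v 1"
  by (simp add: completion_at_def FactRing_def embed_def cauchy_ring_def)

lemma embed_in_carrier:
  assumes "v \<in> places" shows "embed v c \<in> carrier (completion_at v)"
proof -
  have "place_abs v 0 = 0"
    using absolute_value_eq_0[OF absolute_value_place_abs[OF assms], of 0] by simp
  then have "(\<lambda>_. c) \<in> carrier (cauchy_ring v)" by (simp add: cauchy_ring_def)
  then show ?thesis by (auto simp: completion_at_def FactRing_def A_RCOSETS_def' embed_def)
qed

text \<open>The reverse triangle inequality makes the absolute values along every representative
  converge to that of c; the constant representative makes the limit unique.\<close>

lemma completion_abs_embed:
  assumes "v \<in> places" shows "completion_abs v (embed v c) = place_abs v c"
proof -
  have av: "absolute_value (place_abs v)" using assms by (rule absolute_value_place_abs)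
  have lim: "(\<lambda>n. place_abs v (t n)) \<longlonglongrightarrow> place_abs v c" if t: "t \<in> embed v c" for t
  proof -
    obtain s where s: "t = (\<lambda>n. s n + c)" "(\<lambda>n. place_abs v (s n)) \<longlonglongrightarrow> 0"
      using t by (auto simp: embed_eq null_ideal_def)
    have "(\<lambda>n. place_abs v (s n + c) - place_abs v c) \<longlonglongrightarrow> 0"
      by (rule Lim_null_comparison[OF always_eventually s(2)])
         (simp add: absolute_value_diff_le[OF av])
    then show ?thesis unfolding s(1) by (simp add: LIM_zero_iff)
  qed
  show ?thesis
    unfolding completion_abs_def
  proof (rule the_equality)
    show "\<forall>t\<in>embed v c. (\<lambda>n. place_abs v (t n)) \<longlonglongrightarrow> place_abs v c" using lim by blast
    fix r assume "\<forall>t\<in>embed v c. (\<lambda>n. place_abs v (t n)) \<longlonglongrightarrow> r"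
    then have "(\<lambda>n. place_abs v c) \<longlonglongrightarrow> r" using const_in_embed_iff[OF assms] by fast
    then show "r = place_abs v c" using LIMSEQ_unique tendsto_const by blast
  qed
qed

lemma embed_in_valuation_ring:
  "v \<in> places \<Longrightarrow> place_abs v c \<le> 1 \<Longrightarrow> embed v c \<in> valuation_ring v"
  by (simp add: valuation_ring_def embed_in_carrier completion_abs_embed)

section \<open>Boolean combinations of open sets\<close>

text \<open>A subbase closed under binary intersections is a base; the closure enters in the
  intersection case of the induction.\<close>

lemma topology_generated_by_local_base:
  assumes "openin (topology_generated_by \<B>) U" "x \<in> U"
    and "\<And>V W. V \<in> \<B> \<Longrightarrow> W \<in> \<B> \<Longrightarrow> V \<inter> W \<in> \<B>"
  shows "\<exists>V\<in>\<B>. x \<in> V \<and> V \<subseteq> U"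
proof -
  have "generate_topology_on \<B> U" using assms(1) by (rule openin_topology_generated_by)
  then show ?thesis
    using assms(2)
  proof induction
    case (Int a b)
    then obtain V W where "V \<in> \<B>" "x \<in> V" "V \<subseteq> a" "W \<in> \<B>" "x \<in> W" "W \<subseteq> b" by blast
    then show ?case using assms(3)[of V W] by blast
  next
    case (UN K)
    then obtain k where "k \<in> K" "x \<in> k" by blast
    with UN.IH[of k] show ?case by blast
  qed auto
qed

text \<open>A complement exchanges the two alternatives, and for unions and intersections
  \<open>W\<close> is shrunk twice, first to decide S and then T. The smaller set stays in
  \<open>\<B>\<close> and still meets \<open>F\<close>, so that shrinking can be repeated.\<close>

lemma boolean_combination_locally_decided:
  assumes "S \<in> boolean_combinations \<Omega> G" "F \<subseteq> \<Omega>"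
    and "\<And>U W. U \<in> G \<Longrightarrow> W \<in> \<B> \<Longrightarrow> W \<inter> F \<noteq> {} \<Longrightarrow>
      \<exists>V\<in>\<B>. V \<subseteq> W \<and> V \<inter> F \<noteq> {} \<and> (V \<inter> F \<subseteq> U \<or> V \<inter> F \<inter> U = {})"
    and "W \<in> \<B>" "W \<inter> F \<noteq> {}"
  shows "\<exists>V\<in>\<B>. V \<subseteq> W \<and> V \<inter> F \<noteq> {} \<and> (V \<inter> F \<subseteq> S \<or> V \<inter> F \<inter> S = {})"
  using assms(1,4,5)
proof (induction arbitrary: W)
  case (generator S)
  then show ?case by (rule assms(3))
next
  case (complement S)
  then obtain V where V: "V \<in> \<B>" "V \<subseteq> W" "V \<inter> F \<noteq> {}" "V \<inter> F \<subseteq> S \<or> V \<inter> F \<inter> S = {}"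
    by blast
  then have "V \<inter> F \<subseteq> \<Omega> - S \<or> V \<inter> F \<inter> (\<Omega> - S) = {}" using assms(2) by blast
  with V show ?case by blast
next
  case (union S T)
  obtain V where V: "V \<in> \<B>" "V \<subseteq> W" "V \<inter> F \<noteq> {}" "V \<inter> F \<subseteq> S \<or> V \<inter> F \<inter> S = {}"
    using union.IH(1)[OF union.prems] by blast
  obtain V' where V': "V' \<in> \<B>" "V' \<subseteq> V" "V' \<inter> F \<noteq> {}" "V' \<inter> F \<subseteq> T \<or> V' \<inter> F \<inter> T = {}"
    using union.IH(2)[OF V(1,3)] by blast
  have "V' \<inter> F \<subseteq> S \<union> T \<or> V' \<inter> F \<inter> (S \<union> T) = {}" using V(2,4) V'(2,4) by blast
  moreover have "V' \<subseteq> W" using V(2) V'(2) by blast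
  ultimately show ?case using V'(1,3) by blast
next
  case (intersection S T)
  obtain V where V: "V \<in> \<B>" "V \<subseteq> W" "V \<inter> F \<noteq> {}" "V \<inter> F \<subseteq> S \<or> V \<inter> F \<inter> S = {}"
    using intersection.IH(1)[OF intersection.prems] by blast
  obtain V' where V': "V' \<in> \<B>" "V' \<subseteq> V" "V' \<inter> F \<noteq> {}" "V' \<inter> F \<subseteq> T \<or> V' \<inter> F \<inter> T = {}"
    using intersection.IH(2)[OF V(1,3)] by blast
  have "V' \<inter> F \<subseteq> S \<inter> T \<or> V' \<inter> F \<inter> (S \<inter> T) = {}" using V(2,4) V'(2,4) by blast
  moreover have "V' \<subseteq> W" using V(2) V'(2) by blast
  ultimately show ?case using V'(1,3) by blast
qed

section \<open>Basic open sets of the adeles and the density argument\<close>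

lemma adele_basic_open_sets_Int:
  assumes "V \<in> adele_basic_open_sets" "W \<in> adele_basic_open_sets"
  shows "V \<inter> W \<in> adele_basic_open_sets"
proof -
  obtain A where A: "V = (\<Pi>\<^sub>E v\<in>places. A v)" "\<And>v. v \<in> places \<Longrightarrow> openin (completion_topology v) (A v)"
    "finite {v \<in> places. nonarchimedean v \<and> A v \<noteq> valuation_ring v}"
    using assms(1) unfolding adele_basic_open_sets_def by blast
  obtain B where B: "W = (\<Pi>\<^sub>E v\<in>places. B v)" "\<And>v. v \<in> places \<Longrightarrow> openin (completion_topology v) (B v)"
    "finite {v \<in> places. nonarchimedean v \<and> B v \<noteq> valuation_ring v}"
    using assms(2) unfolding adele_basic_open_sets_def by blast
  have "V \<inter> W = (\<Pi>\<^sub>E v\<in>places. A v \<inter> B v)" unfolding A B by (rule PiE_Int)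
  moreover have "finite {v \<in> places. nonarchimedean v \<and> A v \<inter> B v \<noteq> valuation_ring v}"
    by (rule finite_subset[OF _ finite_UnI[OF A(3) B(3)]]) auto
  moreover have "\<forall>v\<in>places. openin (completion_topology v) (A v \<inter> B v)"
    using A(2) B(2) by (blast intro: openin_Int)
  ultimately show ?thesis
    unfolding adele_basic_open_sets_def by blast
qed

text \<open>Adding UNIV to the basic open sets makes it unnecessary to show that they cover the adeles
  (i.e. that the valuation rings are open).\<close>

lemma modify_adele:
  assumes "a \<in> carrier adele_ring" "a \<in> W" "W \<in> insert UNIV adele_basic_open_sets"
    and c: "\<And>v. v \<in> places \<Longrightarrow> c v \<in> valuation_ring v"
  obtains E where "finite E"
    "(\<lambda>v\<in>places. if nonarchimedean v \<and> v \<notin> E then c v else a v) \<in> carrier adele_ring \<inter> W"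
proof -
  let ?I = "{v \<in> places. nonarchimedean v \<and> a v \<notin> valuation_ring v}"
  have a: "a \<in> (\<Pi>\<^sub>E v\<in>places. carrier (completion_at v))" "finite ?I"
    using assms(1) by (auto simp: adele_ring_def)
  have carr: "(\<lambda>v\<in>places. if nonarchimedean v \<and> v \<notin> E then c v else a v) \<in> carrier adele_ring" for E
  \<comment> \<open>The new values are integral, so the modified adele is non-integral only where
    \<open>a\<close> already was, for any choice of E.\<close>
  proof -
    have "{v \<in> places. nonarchimedean v \<and>
        (\<lambda>v\<in>places. if nonarchimedean v \<and> v \<notin> E then c v else a v) v \<notin> valuation_ring v} \<subseteq> ?I"
      using c by (auto split: if_splits)
    from finite_subset[OF this a(2)] show ?thesis
      using a(1) c by (auto simp: adele_ring_def valuation_ring_def PiE_iff)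
  qed
  show ?thesis
  proof (cases "W = UNIV")
    case True
    show ?thesis by (rule that[of "{}"]) (use True carr[of "{}"] in auto)
  next
    case False
    then obtain U where U: "W = (\<Pi>\<^sub>E v\<in>places. U v)"
      "finite {v \<in> places. nonarchimedean v \<and> U v \<noteq> valuation_ring v}"
      using assms(3) unfolding adele_basic_open_sets_def by blast
    \<comment> \<open>Outside this finite set the factor at a nonarchimedean place is the whole
      valuation ring, so any integral value may be inserted there.\<close>
    let ?E = "{v \<in> places. nonarchimedean v \<and> U v \<noteq> valuation_ring v}"
    have "(\<lambda>v\<in>places. if nonarchimedean v \<and> v \<notin> ?E then c v else a v) \<in> W"
      using c assms(2) unfolding U(1) by (auto simp: PiE_iff)
    then show ?thesis using that[OF U(2)] carr[of ?E] by blast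
  qed
qed

theorem theorem8p4:
  assumes "number_field TYPE('a::field_char_0)"
  shows "{a \<in> carrier (adele_ring :: 'a adele ring).
            finite {v \<in> places. a v \<notin> {\<zero>\<^bsub>completion_at v\<^esub>, \<one>\<^bsub>completion_at v\<^esub>}}}
         \<notin> boolean_combinations (carrier (adele_ring :: 'a adele ring))
             {U. openin (adele_topology :: 'a adele topology) U}"
proof
  define X where "X = {a \<in> carrier (adele_ring :: 'a adele ring).
            finite {v \<in> places. a v \<notin> {\<zero>\<^bsub>completion_at v\<^esub>, \<one>\<^bsub>completion_at v\<^esub>}}}"
  let ?B = "insert UNIV adele_basic_open_sets :: 'a adele set set"
  \<comment> \<open>On \<open>F\<close>, membership in \<open>X\<close> depends on the
    nonarchimedean places alone, and the modifications of \<open>modify_adele\<close> leave the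
    archimedean values unchanged.\<close>
  define F where "F = {a \<in> carrier (adele_ring :: 'a adele ring).
            \<forall>v\<in>places. \<not> nonarchimedean v \<longrightarrow> a v = embed v 0}"
  assume "X \<in> boolean_combinations (carrier adele_ring) {U. openin adele_topology U}"
  have int: "embed v 0 \<in> valuation_ring v" "embed v (- 1) \<in> valuation_ring v" if "v \<in> places" for v :: "'a place"
  proof -
    have av: "absolute_value (place_abs v)" using that by (rule absolute_value_place_abs)
    show "embed v 0 \<in> valuation_ring v" "embed v (- 1) \<in> valuation_ring v"
      using that absolute_value_eq_0[OF av, of 0] absolute_value_minus[OF av, of 1]
        absolute_value_1[OF av] by (auto intro!: embed_in_valuation_ring)
  qed
  \<comment> \<open>If \<open>W\<close> meets \<open>F\<close> and U in a common point, a basic set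
    around that point inside U is intersected with \<open>W\<close>; otherwise \<open>W\<close>
    itself misses U on \<open>F\<close>.\<close>
  have open_decided: "\<exists>V\<in>?B. V \<subseteq> W \<and> V \<inter> F \<noteq> {} \<and> (V \<inter> F \<subseteq> U \<or> V \<inter> F \<inter> U = {})"
    if "U \<in> {U. openin adele_topology U}" "W \<in> ?B" "W \<inter> F \<noteq> {}" for U W
  proof (cases "W \<inter> F \<inter> U = {}")
    case True
    then show ?thesis using that by blast
  next
    case False
    then obtain a where a: "a \<in> W" "a \<in> F" "a \<in> U" by blast
    have "openin (topology_generated_by adele_basic_open_sets) U"
      using that(1) by (simp add: adele_topology_def)
    from topology_generated_by_local_base[OF this a(3) adele_basic_open_sets_Int]
    obtain V where V: "V \<in> adele_basic_open_sets" "a \<in> V" "V \<subseteq> U" by blast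
    have "V \<inter> W \<in> ?B" using V(1) that(2) adele_basic_open_sets_Int by auto
    moreover have "V \<inter> W \<subseteq> W" "V \<inter> W \<inter> F \<noteq> {}" "V \<inter> W \<inter> F \<subseteq> U" using V a by auto
    ultimately show ?thesis by blast
  qed
  have "F \<subseteq> carrier adele_ring" by (auto simp: F_def)
  \<comment> \<open>The zero adele shows that \<open>UNIV\<close>, the initial member of
    \<open>?B\<close>, meets \<open>F\<close>.\<close>
  moreover have "(\<lambda>v\<in>places. embed v 0) \<in> F"
    using int(1) embed_in_carrier by (auto simp: F_def adele_ring_def)
  ultimately obtain V where V: "V \<in> ?B" "V \<inter> F \<noteq> {}" "V \<inter> F \<subseteq> X \<or> V \<inter> F \<inter> X = {}"
    using boolean_combination_locally_decided[OF \<open>X \<in> _\<close> _ open_decided, of UNIV] by blast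
  then obtain a where a: "a \<in> carrier adele_ring" "a \<in> V"
    "\<And>v. v \<in> places \<Longrightarrow> \<not> nonarchimedean v \<Longrightarrow> a v = embed v 0" by (auto simp: F_def)
  let ?m = "\<lambda>c E. \<lambda>v\<in>places. if nonarchimedean v \<and> v \<notin> E then embed v c else a v"
  have modF: "?m c E \<in> F" if "?m c E \<in> carrier adele_ring" for c E
    using that a(3) by (auto simp: F_def)
  obtain E where E: "finite E" "?m 0 E \<in> carrier adele_ring \<inter> V"
    using modify_adele[OF a(1,2) V(1) int(1)] .
  \<comment> \<open>Outside E every component is 0: at archimedean places because \<open>a\<close>
    lies in \<open>F\<close>, elsewhere by the modification.\<close>
  have "finite {v \<in> places. ?m 0 E v \<notin> {\<zero>\<^bsub>completion_at v\<^esub>, \<one>\<^bsub>completion_at v\<^esub>}}"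
    by (rule finite_subset[OF _ E(1)]) (auto simp: zero_completion_at a(3) split: if_splits)
  then have "?m 0 E \<in> V \<inter> F \<inter> X" using E modF[OF IntD1[OF E(2)]] by (auto simp: X_def)
  moreover obtain E' where E': "finite E'" "?m (- 1) E' \<in> carrier adele_ring \<inter> V"
    using modify_adele[OF a(1,2) V(1) int(2)] .
  have "infinite ({v \<in> places :: 'a place set. nonarchimedean v} - E')"
    using infinite_nonarchimedean_places[OF assms] E'(1) by (rule Diff_infinite_finite[rotated])
  \<comment> \<open>In characteristic 0 the element -1 differs from 0 and 1, so every nonarchimedean
    place outside \<open>E'\<close> is counted.\<close>
  then have "infinite {v \<in> places. ?m (- 1) E' v \<notin> {\<zero>\<^bsub>completion_at v\<^esub>, \<one>\<^bsub>completion_at v\<^esub>}}"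
    by (rule infinite_super[rotated])
       (auto simp: zero_completion_at one_completion_at embed_inject)
  then have "?m (- 1) E' \<in> V \<inter> F - X" using E' modF[OF IntD1[OF E'(2)]] by (auto simp: X_def)
  ultimately show False using V(3) by blast
qed

end
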